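(* Let $k>3$ be a real number, and let $$A=(0,0,3),\quad B=(\sqrt{8},0,-1),\quad C=(-\sqrt{2},\sqrt{6},-1),\quad D=(-\sqrt{2},-\sqrt{6},-1),$$ $$E=\left(0,0,-\tfrac{3}{k}\right),\quad F=\left(-\tfrac{\sqrt{8}}{k},0,\tfrac{1}{k}\right),\quad G=\left(\tfrac{\sqrt{2}}{k},-\tfrac{\sqrt{6}}{k},\tfrac{1}{k}\right),\quad H=\left(\tfrac{\sqrt{2}}{k},\tfrac{\sqrt{6}}{k},\tfrac{1}{k}\right)$$ be points in $\mathbb{R}^3$. Let $O_4=K_{2,2,2,2}$ be the vertex-labeled graph on the vertex set $\{A,B,C,D,E,F,G,H\}$ in which all pairs of distinct vertices are adjacent except $\{A,E\}$, $\{B,F\}$, $\{C,G\}$, $\{D,H\}$. Then all the twelve triangulations of the 2-torus with the vertex-labeled graph $O_4$ are realized geometrically in $\mathbb{R}^3$ with the same 1-skeleton, the eight vertices being placed at the points given above. That is, for every triangulation $T$ of the 2-torus with this vertex-labeled graph, placing each vertex at the point of the same name, each edge as the straight segment between its endpoints, and each face as the convex hull of its three vertices yields a geometric realization of $T$ in $\mathbb{R}^3$.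
   Context: A triangulation of a closed surface $S$ with a vertex-labeled graph $\Gamma$ is an abstract 2-dimensional simplicial complex whose underlying space is homeomorphic to $S$ and whose 1-skeleton is exactly the labeled graph $\Gamma$ (same labeled vertices, same edges). Its faces are its 2-simplices, regarded as 3-element sets of labeled vertices. Two triangulations with the same vertex-labeled graph are considered different if their face sets differ. It is known that there are precisely twelve pairwise different triangulations of the 2-torus with the vertex-labeled graph $O_4=K_{2,2,2,2}$. A geometric realization of an abstract triangulation $T$ in $\mathbb{R}^n$ is a polyhedron in $\mathbb{R}^n$, all of whose faces are (nondegenerate) geometric simplices, whose polyhedral structure is isomorphic to $T$ and which is free from self-intersections. Equivalently, vertices are represented by points, each simplex of $T$ is represented by the convex hull of its vertices, and any two such geometric simplices intersect exactly in the geometric simplex spanned by their common vertices (or are disjoint if they have no common vertex). *)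

theory Defs
  imports "HOL-Analysis.Analysis"
begin

definition abstract_simplicial_complex :: "'v set set \<Rightarrow> bool" where
  "abstract_simplicial_complex K \<longleftrightarrow>
     {} \<notin> K \<and> (\<forall>\<sigma>\<in>K. finite \<sigma>) \<and> (\<forall>\<sigma>\<in>K. \<forall>\<tau>. \<tau> \<subseteq> \<sigma> \<and> \<tau> \<noteq> {} \<longrightarrow> \<tau> \<in> K)"

definition two_dimensional :: "'v set set \<Rightarrow> bool" where
  "two_dimensional K \<longleftrightarrow> (\<forall>\<sigma>\<in>K. card \<sigma> \<le> 3) \<and> (\<exists>\<sigma>\<in>K. card \<sigma> = 3)"

text \<open>The underlying space is the standard one: the vertex \<open>v\<close> is placed at the basis
  vector \<open>axis v 1\<close>, and each simplex spans the convex hull of its vertices.\<close>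

definition underlying_space :: "'v::finite set set \<Rightarrow> (real^'v) set" where
  "underlying_space K = (\<Union>\<sigma>\<in>K. convex hull ((\<lambda>v. axis v 1) ` \<sigma>))"

text \<open>The labeled graph is given by its set \<open>V\<close> of vertices and its set \<open>Es\<close> of edges, an edge
  being a two-element set. As the 1-skeleton is prescribed, two such complexes are equal
  if and only if they have the same 2-simplices.\<close>

definition triangulation_with_graph ::
  "'s::topological_space set \<Rightarrow> 'v::finite set \<Rightarrow> 'v set set \<Rightarrow> 'v set set \<Rightarrow> bool" where
  "triangulation_with_graph S V Es K \<longleftrightarrow>
     abstract_simplicial_complex K \<and> two_dimensional K \<and>
     {v. {v} \<in> K} = V \<and> {\<sigma>\<in>K. card \<sigma> = 2} = Es \<and>
     underlying_space K homeomorphic S"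

definition torus :: "(complex \<times> complex) set" where
  "torus = sphere 0 1 \<times> sphere 0 1"

text \<open>For simplices without a common vertex the last condition says that their hulls are
  disjoint, since the convex hull of the empty set is empty.\<close>

definition geometric_realization ::
  "'v set set \<Rightarrow> ('v \<Rightarrow> 'a::euclidean_space) \<Rightarrow> bool" where
  "geometric_realization K p \<longleftrightarrow>
     (\<forall>\<sigma>\<in>K. inj_on p \<sigma> \<and> \<not> affine_dependent (p ` \<sigma>)) \<and>
     (\<forall>\<sigma>\<in>K. \<forall>\<tau>\<in>K. convex hull (p ` \<sigma>) \<inter> convex hull (p ` \<tau>) = convex hull (p ` (\<sigma> \<inter> \<tau>)))"

datatype vertex = A | B | C | D | E | F | G | H

lemma UNIV_vertex: "UNIV = {A, B, C, D, E, F, G, H}"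
  using vertex.exhaust by auto

instance vertex :: finite
  by standard (simp add: UNIV_vertex)

definition O4_edges :: "vertex set set" where
  "O4_edges = {e. card e = 2} - {{A, E}, {B, F}, {C, G}, {D, H}}"

fun position :: "real \<Rightarrow> vertex \<Rightarrow> real^3" where
  "position k A = vector [0, 0, 3]"
| "position k B = vector [sqrt 8, 0, -1]"
| "position k C = vector [- sqrt 2, sqrt 6, -1]"
| "position k D = vector [- sqrt 2, - sqrt 6, -1]"
| "position k E = vector [0, 0, - (3 / k)]"
| "position k F = vector [- (sqrt 8 / k), 0, 1 / k]"
| "position k G = vector [sqrt 2 / k, - (sqrt 6 / k), 1 / k]"
| "position k H = vector [sqrt 2 / k, sqrt 6 / k, 1 / k]"

end

theory Submission
  imports Defs
begin

text \<open>
  The eight points are the vertices of a Schlegel diagram of the 16-cell: \<open>A, B, C, D\<close> span a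
  regular tetrahedron centred at the origin, and the antipode of each of them is its image under
  scaling by \<open>- 1 / k\<close>. The simplices of a triangulation with graph \<open>O\<^sub>4\<close> contain no antipodal
  pair and have at most three vertices, so they are faces of the 16-cell other than the facet
  \<open>ABCD\<close>. All of these faces together embed in the diagram, so that the argument is about the
  16-cell and not about single triangulations.

  To see the embedding, collect the weights \<open>w\<close> of a convex combination of the eight points into
  the four numbers \<open>t i = w i - w (antipode i) / k\<close>, one for each outer vertex \<open>i\<close>. If the support
  of \<open>w\<close> has no antipodal pair, then \<open>t\<close> determines \<open>w\<close>, and the total weight 1 is the sum of the
  values \<open>gauge_of k (t i) = max (t i) (- k * t i)\<close>. As every linear relation between the outer
  points has equal coefficients (\<open>outer_relation\<close>), the numbers of two combinations that
  give the same point differ by one constant \<open>c\<close>. Increasing all four numbers by \<open>c > 0\<close>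
  raises each gauge by at most \<open>c\<close>, but lowers it by \<open>k * c\<close> where the increased number is not
  positive. Such a place exists because the simplex is not \<open>ABCD\<close>, and it outweighs the three
  others because \<open>k > 3\<close>; so the total cannot remain 1, and \<open>c = 0\<close> (\<open>gauge_sum_shift\<close>).
  Hence a point has at most one representation by weights on these simplices
  (\<open>weights_unique\<close>). This gives the intersection condition, and nondegeneracy follows from it by
  Radon's theorem (\<open>geometric_realizationI\<close>).
\<close>

section \<open>Weights of convex combinations\<close>

definition weights_on :: "'v set \<Rightarrow> ('v::finite \<Rightarrow> real) \<Rightarrow> bool" where
  "weights_on \<sigma> w \<longleftrightarrow> (\<forall>v. 0 \<le> w v) \<and> (\<forall>v. v \<notin> \<sigma> \<longrightarrow> w v = 0) \<and> sum w UNIV = 1"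

lemma weights_on_Int:
  assumes "weights_on \<sigma> w" "weights_on \<tau> w"
  shows "weights_on (\<sigma> \<inter> \<tau>) w"
  using assms by (auto simp: weights_on_def)

text \<open>Indexing the weights by labels instead of points makes sense even where \<open>p\<close> is not known to be
  injective.\<close>

lemma in_convex_hull_image_iff:
  fixes p :: "'v::finite \<Rightarrow> 'a::real_vector"
  shows "x \<in> convex hull (p ` \<sigma>) \<longleftrightarrow> (\<exists>w. weights_on \<sigma> w \<and> x = (\<Sum>v\<in>UNIV. w v *\<^sub>R p v))"
proof
  let ?S = "{x. \<exists>w. weights_on \<sigma> w \<and> x = (\<Sum>v\<in>UNIV. w v *\<^sub>R p v)}"
  assume x: "x \<in> convex hull (p ` \<sigma>)"
  have "p v \<in> ?S" if "v \<in> \<sigma>" for v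
  proof -
    let ?w = "\<lambda>u. if u = v then 1 else 0 :: real"
    have "(\<Sum>u\<in>UNIV. ?w u *\<^sub>R p u) = (\<Sum>u\<in>UNIV. if u = v then p u else 0)"
      by (rule sum.cong) auto
    then have "weights_on \<sigma> ?w \<and> p v = (\<Sum>u\<in>UNIV. ?w u *\<^sub>R p u)"
      using that by (auto simp: weights_on_def)
    then show ?thesis by blast
  qed
  moreover have "convex ?S"
  proof (rule convexI)
    fix x y and a b :: real
    assume "x \<in> ?S" "y \<in> ?S" and ab: "0 \<le> a" "0 \<le> b" "a + b = 1"
    then obtain f g where fg: "weights_on \<sigma> f" "weights_on \<sigma> g"
      and xy: "x = (\<Sum>v\<in>UNIV. f v *\<^sub>R p v)" "y = (\<Sum>v\<in>UNIV. g v *\<^sub>R p v)"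
      by blast
    let ?w = "\<lambda>v. a * f v + b * g v"
    have "weights_on \<sigma> ?w"
      using fg ab by (simp add: weights_on_def sum.distrib flip: sum_distrib_left)
    moreover have "a *\<^sub>R x + b *\<^sub>R y = (\<Sum>v\<in>UNIV. ?w v *\<^sub>R p v)"
      by (simp add: xy scaleR_add_left sum.distrib scaleR_sum_right)
    ultimately show "a *\<^sub>R x + b *\<^sub>R y \<in> ?S" by blast
  qed
  ultimately have "convex hull (p ` \<sigma>) \<subseteq> ?S"
    by (intro hull_minimal) auto
  with x show "\<exists>w. weights_on \<sigma> w \<and> x = (\<Sum>v\<in>UNIV. w v *\<^sub>R p v)" by blast
next
  assume "\<exists>w. weights_on \<sigma> w \<and> x = (\<Sum>v\<in>UNIV. w v *\<^sub>R p v)"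
  then obtain w where w: "weights_on \<sigma> w" and x: "x = (\<Sum>v\<in>UNIV. w v *\<^sub>R p v)" by blast
  have "sum w \<sigma> = sum w UNIV"
    using w by (intro sum.mono_neutral_left) (auto simp: weights_on_def)
  then have "sum w \<sigma> = 1" using w by (simp add: weights_on_def)
  have x': "x = (\<Sum>v\<in>\<sigma>. w v *\<^sub>R p v)"
    unfolding x using w by (intro sum.mono_neutral_right) (auto simp: weights_on_def)
  from \<open>sum w \<sigma> = 1\<close> show "x \<in> convex hull (p ` \<sigma>)"
    unfolding x' using w by (intro convex_sum) (auto simp: weights_on_def hull_inc)
qed

text \<open>Degenerate simplices need no separate treatment: by Radon's theorem, a degenerate simplex has
  two disjoint faces with intersecting hulls.\<close>

lemma geometric_realizationI:
  fixes p :: "'v \<Rightarrow> 'a::euclidean_space"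
  assumes down: "\<And>\<sigma> \<tau>. \<sigma> \<in> K \<Longrightarrow> \<tau> \<subseteq> \<sigma> \<Longrightarrow> \<tau> \<noteq> {} \<Longrightarrow> \<tau> \<in> K"
    and inter: "\<And>\<sigma> \<tau>. \<sigma> \<in> K \<Longrightarrow> \<tau> \<in> K \<Longrightarrow>
      convex hull (p ` \<sigma>) \<inter> convex hull (p ` \<tau>) = convex hull (p ` (\<sigma> \<inter> \<tau>))"
  shows "geometric_realization K p"
proof -
  have disj: "convex hull (p ` \<mu>) \<inter> convex hull (p ` \<nu>) = {}"
    if "\<sigma> \<in> K" "\<mu> \<subseteq> \<sigma>" "\<nu> \<subseteq> \<sigma>" "\<mu> \<inter> \<nu> = {}" for \<sigma> \<mu> \<nu>
  proof (cases "\<mu> = {} \<or> \<nu> = {}")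
    case False
    then show ?thesis using that inter[of \<mu> \<nu>] down by simp
  qed auto
  have "inj_on p \<sigma>" if "\<sigma> \<in> K" for \<sigma>
  proof (rule inj_onI)
    fix v w assume "v \<in> \<sigma>" "w \<in> \<sigma>" "p v = p w"
    then show "v = w" using disj[OF that, of "{v}" "{w}"] by auto
  qed
  moreover have "\<not> affine_dependent (p ` \<sigma>)" if "\<sigma> \<in> K" for \<sigma>
  proof
    assume "affine_dependent (p ` \<sigma>)"
    then obtain m n where mn: "m \<subseteq> p ` \<sigma>" "n \<subseteq> p ` \<sigma>" "m \<inter> n = {}"
        "convex hull m \<inter> convex hull n \<noteq> {}"
      by (rule Radon)
    define \<mu> \<nu> where "\<mu> = \<sigma> \<inter> p -` m" and "\<nu> = \<sigma> \<inter> p -` n"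
    have "m = p ` \<mu>" "n = p ` \<nu>" "\<mu> \<inter> \<nu> = {}" "\<mu> \<subseteq> \<sigma>" "\<nu> \<subseteq> \<sigma>"
      using mn by (auto simp: \<mu>_def \<nu>_def)
    with mn(4) disj[OF that] show False by auto
  qed
  ultimately show ?thesis using inter by (simp add: geometric_realization_def)
qed

section \<open>The gauge of a signed weight\<close>

text \<open>With \<open>t\<close> a signed weight, this is the total weight at an outer vertex and its antipode: a
  negative \<open>t\<close> stands for the weight \<open>- k * t\<close> at the antipode, which lies \<open>k\<close> times closer to
  the origin.\<close>

definition gauge_of :: "real \<Rightarrow> real \<Rightarrow> real" where
  "gauge_of k t = max t (- k * t)"

lemma gauge_of_add_le:
  assumes "0 \<le> k" "0 \<le> c"
  shows "gauge_of k (t + c) \<le> gauge_of k t + c"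
  using mult_nonneg_nonneg[OF assms] assms unfolding gauge_of_def distrib_left by linarith

lemma gauge_of_nonpos:
  assumes "0 \<le> k" "t \<le> 0"
  shows "gauge_of k t = - k * t"
  using mult_nonneg_nonpos[OF assms] assms by (simp add: gauge_of_def max_def)

text \<open>The gauge has slope at most 1 everywhere and slope \<open>- k\<close> up to 0. So one index that stays
  nonpositive loses \<open>k * c\<close>, more than the \<open>(card I - 1) * c\<close> that all others can gain.\<close>

lemma gauge_sum_shift_less:
  assumes I: "finite I" "j \<in> I" and k: "real (card I) - 1 < k"
    and c: "0 < c" and j: "r j + c \<le> 0"
  shows "(\<Sum>i\<in>I. gauge_of k (r i + c)) < (\<Sum>i\<in>I. gauge_of k (r i))"
proof -
  have "card I > 0" using I by (auto simp: card_gt_0_iff)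
  then have card: "real (card (I - {j})) = real (card I) - 1" and "0 \<le> k"
    using I k by auto
  have "(\<Sum>i\<in>I. gauge_of k (r i + c))
      = gauge_of k (r j + c) + (\<Sum>i\<in>I - {j}. gauge_of k (r i + c))"
    using I by (rule sum.remove)
  also have "\<dots> \<le> gauge_of k (r j + c) + (\<Sum>i\<in>I - {j}. gauge_of k (r i) + c)"
    using \<open>0 \<le> k\<close> c by (intro add_left_mono sum_mono gauge_of_add_le) auto
  also have "\<dots> = gauge_of k (r j) - k * c + (\<Sum>i\<in>I - {j}. gauge_of k (r i)) + (real (card I) - 1) * c"
    using \<open>0 \<le> k\<close> c j unfolding sum.distrib sum_constant card
    by (simp add: gauge_of_nonpos algebra_simps)
  also have "\<dots> < gauge_of k (r j) + (\<Sum>i\<in>I - {j}. gauge_of k (r i))"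
    using mult_strict_right_mono[OF k c] by simp
  also have "\<dots> = (\<Sum>i\<in>I. gauge_of k (r i))"
    using I by (rule sum.remove[symmetric])
  finally show ?thesis .
qed

lemma gauge_sum_shift:
  assumes I: "finite I" and k: "real (card I) - 1 < k"
    and j: "\<exists>j\<in>I. r j \<le> 0" "\<exists>j\<in>I. t j \<le> 0"
    and shift: "\<And>i. i \<in> I \<Longrightarrow> t i = r i + c"
    and eq: "(\<Sum>i\<in>I. gauge_of k (t i)) = (\<Sum>i\<in>I. gauge_of k (r i))"
  shows "c = 0"
proof (rule ccontr)
  assume "c \<noteq> 0"
  then consider "0 < c" | "0 < - c" by linarith
  then show False
  proof cases
    case 1
    from j shift obtain j where "j \<in> I" "r j + c \<le> 0" by force
    from gauge_sum_shift_less[where r = r, OF I this(1) k 1 this(2)] eq shift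
    show False by simp
  next
    case 2
    from j shift obtain j where "j \<in> I" "t j + - c \<le> 0" by force
    from gauge_sum_shift_less[where r = t, OF I this(1) k 2 this(2)] eq shift
    show False by simp
  qed
qed

section \<open>The placement of the eight vertices\<close>

fun antipode :: "vertex \<Rightarrow> vertex" where
  "antipode A = E" | "antipode B = F" | "antipode C = G" | "antipode D = H"
| "antipode E = A" | "antipode F = B" | "antipode G = C" | "antipode H = D"

definition outer :: "vertex set" where
  "outer = {A, B, C, D}"

lemma sum_vertex_outer:
  fixes f :: "vertex \<Rightarrow> 'a::comm_monoid_add"
  shows "sum f UNIV = (\<Sum>i\<in>outer. f i + f (antipode i))"
  by (simp add: UNIV_vertex outer_def add_ac)

lemma position_antipode:
  assumes "i \<in> outer"
  shows "position k (antipode i) = - (1 / k) *\<^sub>R position k i"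
  using assms by (auto simp: outer_def vec_eq_iff forall_3)

lemma outer_relation:
  assumes "(\<Sum>i\<in>outer. z i *\<^sub>R position k i) = 0" "i \<in> outer"
  shows "z i = z A"
proof -
  have sqrt8: "sqrt 8 = 2 * sqrt 2"
    using real_sqrt_mult[of 4 2] by simp
  have "sqrt 2 * (2 * z B - z C - z D) = 0" "sqrt 6 * (z C - z D) = 0"
      "3 * z A - z B - z C - z D = 0"
    using assms(1) by (auto simp: outer_def vec_eq_iff forall_3 sqrt8 algebra_simps)
  then show ?thesis using assms(2) by (auto simp: outer_def)
qed

text \<open>These are the faces of the 16-cell apart from \<open>ABCD\<close>, whose hull contains all the others in
  the Schlegel diagram.\<close>

definition diagram_simplex :: "vertex set \<Rightarrow> bool" where
  "diagram_simplex \<sigma> \<longleftrightarrow> (\<forall>v\<in>\<sigma>. antipode v \<notin> \<sigma>) \<and> \<not> outer \<subseteq> \<sigma>"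

definition signed_weight :: "real \<Rightarrow> (vertex \<Rightarrow> real) \<Rightarrow> vertex \<Rightarrow> real" where
  "signed_weight k w i = w i - w (antipode i) / k"

lemma sum_position_eq:
  "(\<Sum>v\<in>UNIV. w v *\<^sub>R position k v) = (\<Sum>i\<in>outer. signed_weight k w i *\<^sub>R position k i)"
  by (simp add: sum_vertex_outer position_antipode signed_weight_def algebra_simps
      cong: sum.cong)

context
  fixes k :: real and \<sigma> :: "vertex set" and w :: "vertex \<Rightarrow> real"
  assumes k: "0 < k" and \<sigma>: "diagram_simplex \<sigma>" and w: "weights_on \<sigma> w"
begin

lemma weight_zero_or_antipode: "w v = 0 \<or> w (antipode v) = 0"
  using \<sigma> w unfolding diagram_simplex_def weights_on_def by blast

lemma weight_outer_eq: "w i = max (signed_weight k w i) 0"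
  and weight_inner_eq: "w (antipode i) = max (- k * signed_weight k w i) 0"
  and gauge_signed_weight: "gauge_of k (signed_weight k w i) = w i + w (antipode i)"
proof -
  let ?s = "signed_weight k w i"
  have nonneg: "0 \<le> w i" "0 \<le> w (antipode i)" using w by (auto simp: weights_on_def)
  have "w i = max ?s 0 \<and> w (antipode i) = max (- k * ?s) 0 \<and> gauge_of k ?s = w i + w (antipode i)"
  proof (cases "w (antipode i) = 0")
    case True
    then have "?s = w i" by (simp add: signed_weight_def)
    moreover have "- k * w i \<le> 0" using k nonneg by simp
    ultimately show ?thesis using True nonneg by (simp add: gauge_of_def max_absorb1 max_absorb2)
  next
    case False
    then have "w i = 0" using weight_zero_or_antipode[of i] by simp
    moreover from this have "w (antipode i) = - k * ?s" using k by (simp add: signed_weight_def)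
    moreover have "?s \<le> 0" using \<open>w i = 0\<close> k nonneg by (simp add: signed_weight_def)
    ultimately show ?thesis using nonneg k by (simp add: gauge_of_nonpos max_absorb1 max_absorb2)
  qed
  then show "w i = max ?s 0" "w (antipode i) = max (- k * ?s) 0"
    "gauge_of k ?s = w i + w (antipode i)" by blast+
qed

lemma sum_gauge_signed_weight: "(\<Sum>i\<in>outer. gauge_of k (signed_weight k w i)) = 1"
  using w by (simp add: gauge_signed_weight weights_on_def sum_vertex_outer)

text \<open>At an outer vertex outside \<open>\<sigma>\<close> only its antipode can contribute.\<close>

lemma signed_weight_nonpos: "\<exists>j\<in>outer. signed_weight k w j \<le> 0"
proof -
  obtain j where "j \<in> outer" "j \<notin> \<sigma>" using \<sigma> by (auto simp: diagram_simplex_def)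
  then show ?thesis using w k by (intro bexI[of _ j]) (auto simp: weights_on_def signed_weight_def)
qed

end

text \<open>The two simplices need not be equal: this is what makes the hulls of different faces meet only
  in common faces.\<close>

lemma weights_unique:
  assumes k: "3 < k" and \<sigma>: "diagram_simplex \<sigma>" "weights_on \<sigma> w"
    and \<tau>: "diagram_simplex \<tau>" "weights_on \<tau> w'"
    and eq: "(\<Sum>v\<in>UNIV. w v *\<^sub>R position k v) = (\<Sum>v\<in>UNIV. w' v *\<^sub>R position k v)"
  shows "w = w'"
proof -
  have k0: "0 < k" using k by simp
  let ?t = "signed_weight k w" and ?r = "signed_weight k w'"
  have "(\<Sum>i\<in>outer. (?t i - ?r i) *\<^sub>R position k i) = 0"
    using eq by (simp add: sum_position_eq scaleR_diff_left sum_subtractf)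
  from outer_relation[OF this] have shift: "?t i = ?r i + (?t A - ?r A)" if "i \<in> outer" for i
    using that by force
  have "?t A - ?r A = 0"
  proof (rule gauge_sum_shift[OF _ _ _ _ shift])
    show "real (card outer) - 1 < k" using k by (simp add: outer_def)
  qed (use sum_gauge_signed_weight[OF k0 \<sigma>] sum_gauge_signed_weight[OF k0 \<tau>]
      signed_weight_nonpos[OF k0 \<sigma>] signed_weight_nonpos[OF k0 \<tau>] in \<open>auto simp: outer_def\<close>)
  with shift have t_eq_r: "?t i = ?r i" if "i \<in> outer" for i using that by simp
  have "w i = w' i \<and> w (antipode i) = w' (antipode i)" if "i \<in> outer" for i
    using weight_outer_eq[OF k0 \<sigma>, of i] weight_outer_eq[OF k0 \<tau>, of i]
      weight_inner_eq[OF k0 \<sigma>, of i] weight_inner_eq[OF k0 \<tau>, of i] t_eq_r[OF that]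
    by metis
  then have "w v = w' v" for v by (cases v) (force simp: outer_def)+
  then show ?thesis by blast
qed

lemma hull_diagram_simplex_Int:
  assumes k: "3 < k" and \<sigma>: "diagram_simplex \<sigma>" and \<tau>: "diagram_simplex \<tau>"
  shows "convex hull (position k ` \<sigma>) \<inter> convex hull (position k ` \<tau>)
    = convex hull (position k ` (\<sigma> \<inter> \<tau>))" (is "?S \<inter> ?T = ?U")
proof
  show "?S \<inter> ?T \<subseteq> ?U"
  proof
    fix x assume "x \<in> ?S \<inter> ?T"
    then obtain w w' where w: "weights_on \<sigma> w" "x = (\<Sum>v\<in>UNIV. w v *\<^sub>R position k v)"
      and w': "weights_on \<tau> w'" "x = (\<Sum>v\<in>UNIV. w' v *\<^sub>R position k v)"
      by (auto simp: in_convex_hull_image_iff)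
    have "w = w'"
      using weights_unique[OF k \<sigma> w(1) \<tau> w'(1)] w(2) w'(2) by simp
    with w w' show "x \<in> ?U"
      using weights_on_Int by (auto simp: in_convex_hull_image_iff)
  qed
  show "?U \<subseteq> ?S \<inter> ?T" by (intro Int_greatest hull_mono image_mono) auto
qed

lemma triangulation_face_closed:
  assumes "triangulation_with_graph S V Es K" "\<sigma> \<in> K" "\<tau> \<subseteq> \<sigma>" "\<tau> \<noteq> {}"
  shows "\<tau> \<in> K"
  using assms by (simp add: triangulation_with_graph_def abstract_simplicial_complex_def)

lemma triangulation_diagram_simplex:
  assumes T: "triangulation_with_graph S UNIV O4_edges T" and \<sigma>: "\<sigma> \<in> T"
  shows "diagram_simplex \<sigma>"
  unfolding diagram_simplex_def
proof (intro conjI ballI notI)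
  fix v assume "v \<in> \<sigma>" "antipode v \<in> \<sigma>"
  then have "{v, antipode v} \<in> T"
    by (intro triangulation_face_closed[OF T \<sigma>]) auto
  moreover have "card {v, antipode v} = 2" by (cases v) auto
  ultimately have "{v, antipode v} \<in> O4_edges"
    using T by (auto simp: triangulation_with_graph_def)
  moreover have "{v, antipode v} \<in> {{A, E}, {B, F}, {C, G}, {D, H}}" by (cases v) auto
  ultimately show False by (simp add: O4_edges_def)
next
  assume "outer \<subseteq> \<sigma>"
  then have "card outer \<le> card \<sigma>" by (intro card_mono) auto
  moreover have "card \<sigma> \<le> 3"
    using T \<sigma> by (auto simp: triangulation_with_graph_def two_dimensional_def)
  ultimately show False by (simp add: outer_def)
qed

theorem theorem1:
  fixes k :: real and T :: "vertex set set"
  assumes "k > 3"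
    and "triangulation_with_graph torus UNIV O4_edges T"
  shows "geometric_realization T (position k)"
proof (rule geometric_realizationI)
  fix \<sigma> \<tau> assume "\<sigma> \<in> T" "\<tau> \<subseteq> \<sigma>" "\<tau> \<noteq> {}"
  then show "\<tau> \<in> T" by (rule triangulation_face_closed[OF assms(2)])
next
  fix \<sigma> \<tau> assume "\<sigma> \<in> T" "\<tau> \<in> T"
  then show "convex hull (position k ` \<sigma>) \<inter> convex hull (position k ` \<tau>)
      = convex hull (position k ` (\<sigma> \<inter> \<tau>))"
    using assms by (simp add: hull_diagram_simplex_Int triangulation_diagram_simplex)
qed

end
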